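(* Let $n\ge1$. There is a bijection $$\phi:\mathcal{D}_{2n}\to\{f\in\mathcal{E}_{2n+2}: f\text{ has no even maxima}\}$$ such that for all $\sigma\in\mathcal{D}_{2n}$ and $j\in[2n]$ the following hold: (1) $j$ is an even cycle maximum of $\sigma$ if and only if $j$ is a fixed point of $\phi(\sigma)$; (2) $j$ is an even fixed point of $\sigma$ if and only if $j$ is an isolated fixed point of $\phi(\sigma)$; (3) $j$ is an odd fixed point of $\sigma$ if and only if $j$ is an odd maximum of $\phi(\sigma)$.
   Context: $[m]=\{1,\dots,m\}$. $\mathcal{D}_{2n}$ is the set of D-permutations on $[2n]$: permutations $\sigma$ of $[2n]$ such that $i\le\sigma(i)$ whenever $i$ is odd and $i\ge\sigma(i)$ whenever $i$ is even. A cycle maximum of $\sigma$ is an element that is the largest element of its cycle (fixed points being cycles of length 1). An excedent function on $[m]$ is a map $f:[m]\to[m]$ with $f(i)\ge i$ for all $i$. $\mathcal{E}_{2m}$ is the set of surjective staircases on $[2m]$: excedent functions $f:[2m]\to[2m]$ whose image is exactly $\{2,4,\dots,2m\}$. For an excedent function $f$, a fixed point is a $j$ with $f(j)=j$; it is isolated if $f^{-1}(j)=\{j\}$. For $f\in\mathcal{E}_{2m}$, a maximum of $f$ is a $j\in[2m-2]$ with $f(j)=2m$; it is an even (odd) maximum if $j$ is even (odd). *)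

theory Defs
  imports "HOL-Combinatorics.Combinatorics" "HOL-Library.FuncSet"
begin

text \<open>A permutation of \<open>[2n]\<close> is a total function on \<^typ>\<open>nat\<close> that is the identity
  outside \<open>{1..2*n}\<close> (library notion \<^const>\<open>permutes\<close>).\<close>

definition D_permutations :: "nat \<Rightarrow> (nat \<Rightarrow> nat) set" where
  "D_permutations n = {\<sigma>. \<sigma> permutes {1..2 * n} \<and>
     (\<forall>i\<in>{1..2 * n}. (odd i \<longrightarrow> i \<le> \<sigma> i) \<and> (even i \<longrightarrow> i \<ge> \<sigma> i))}"

text \<open>For a permutation of a finite set, \<^term>\<open>orbit \<sigma> j\<close> is the set of elements of the cycle
  containing \<open>j\<close>.\<close>

definition cycle_maximum :: "(nat \<Rightarrow> nat) \<Rightarrow> nat \<Rightarrow> bool" where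
  "cycle_maximum \<sigma> j \<longleftrightarrow> j \<in> orbit \<sigma> j \<and> (\<forall>i\<in>orbit \<sigma> j. i \<le> j)"

text \<open>Maps \<open>[m] \<rightarrow> [m]\<close> are extensional functions, with the value \<^const>\<open>undefined\<close> outside
  \<open>{1..m}\<close>, so that each map is represented exactly once.\<close>

definition excedent_functions :: "nat \<Rightarrow> (nat \<Rightarrow> nat) set" where
  "excedent_functions m = {f \<in> {1..m} \<rightarrow>\<^sub>E {1..m}. \<forall>i\<in>{1..m}. i \<le> f i}"

text \<open>\<open>surjective_staircases m\<close> is the set \<open>\<E>\<close> with index \<open>2m\<close>.\<close>

definition surjective_staircases :: "nat \<Rightarrow> (nat \<Rightarrow> nat) set" where
  "surjective_staircases m =
     {f \<in> excedent_functions (2 * m). f ` {1..2 * m} = (\<lambda>i. 2 * i) ` {1..m}}"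

text \<open>The bound \<open>m\<close> records the domain \<open>[m]\<close> of the map \<open>f\<close>, which cannot be read off from
  the total function.\<close>

definition fixed_point_on :: "nat \<Rightarrow> (nat \<Rightarrow> nat) \<Rightarrow> nat \<Rightarrow> bool" where
  "fixed_point_on m f j \<longleftrightarrow> j \<in> {1..m} \<and> f j = j"

definition isolated_fixed_point_on :: "nat \<Rightarrow> (nat \<Rightarrow> nat) \<Rightarrow> nat \<Rightarrow> bool" where
  "isolated_fixed_point_on m f j \<longleftrightarrow> fixed_point_on m f j \<and> {i \<in> {1..m}. f i = j} = {j}"

text \<open>For \<open>f\<close> in \<^term>\<open>surjective_staircases m\<close>; the forced values at \<open>2m - 1\<close> and
  \<open>2m\<close> do not count as maxima.\<close>

definition staircase_maximum :: "nat \<Rightarrow> (nat \<Rightarrow> nat) \<Rightarrow> nat \<Rightarrow> bool" where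
  "staircase_maximum m f j \<longleftrightarrow> j \<in> {1..2 * m - 2} \<and> f j = 2 * m"

end

(* Every permutation of [N] is uniquely a product
   (N g(N)) o ... o (2 g(2)) o (1 g(1)) with i <= g(i) <= N: going down from N to 1,
   the letter i is inserted into the cycle notation immediately after g(i), or opens a new cycle
   if g(i) = i.  Hence the cycle maxima are the fixed points of g, and the image of v is
   decided by the last letter inserted after v: it is smaller than v iff g(j) = v for some
   j < v.  So the product is a D-permutation iff each even v is in the image of g and no odd v is
   the image of a smaller letter.  Redirecting the odd fixed points of g to 2n+2 turns such g into
   the surjective staircases without even maxima. *)

theory Submission
  imports Defs
begin

section \<open>Products of transpositions attached to excedent functions\<close>

text \<open>Only the \<open>d\<close> letters above \<open>k\<close> are read. The recursion splits
  off the factor of the smallest letter, which stands rightmost and so acts first; what remains is a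
  product of the same kind on \<open>{Suc k<..Suc k + d}\<close>. Every induction below runs along
  this splitting with \<open>k\<close> arbitrary.\<close>

fun transposition_product :: "(nat \<Rightarrow> nat) \<Rightarrow> nat \<Rightarrow> nat \<Rightarrow> nat \<Rightarrow> nat" where
  "transposition_product g k 0 = id"
| "transposition_product g k (Suc d) =
     transposition_product g (Suc k) d \<circ> transpose (Suc k) (g (Suc k))"

definition excedent_between :: "nat \<Rightarrow> nat \<Rightarrow> (nat \<Rightarrow> nat) \<Rightarrow> bool" where
  "excedent_between k m g \<longleftrightarrow> (\<forall>i\<in>{k<..m}. i \<le> g i \<and> g i \<le> m)"

lemma excedent_between_Suc: "excedent_between k m g \<Longrightarrow> excedent_between (Suc k) m g"
  by (auto simp: excedent_between_def)

lemma transposition_product_cong: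
  "(\<And>i. i \<in> {k<..k + d} \<Longrightarrow> g i = h i) \<Longrightarrow>
     transposition_product g k d = transposition_product h k d"
proof (induction d arbitrary: k)
  case (Suc d)
  have "transposition_product g (Suc k) d = transposition_product h (Suc k) d"
    by (rule Suc.IH) (auto intro: Suc.prems)
  then show ?case using Suc.prems[of "Suc k"] by simp
qed simp

lemma transposition_product_permutes:
  "excedent_between k (k + d) g \<Longrightarrow> transposition_product g k d permutes {k<..k + d}"
proof (induction d arbitrary: k)
  case (Suc d)
  have "transposition_product g (Suc k) d permutes {Suc k<..Suc k + d}"
    using Suc.prems by (intro Suc.IH) (simp add: excedent_between_Suc)
  then have "transposition_product g (Suc k) d permutes {k<..k + Suc d}"
    by (rule permutes_subset) auto
  moreover have "transpose (Suc k) (g (Suc k)) permutes {k<..k + Suc d}"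
    using Suc.prems by (intro permutes_swap_id) (force simp: excedent_between_def)+
  ultimately show ?case
    unfolding transposition_product.simps by (intro permutes_compose)
qed (simp add: permutes_id)

lemma transposition_product_Suc_permutes:
  assumes "excedent_between k (k + Suc d) g"
  shows "transposition_product g (Suc k) d permutes {Suc k<..Suc k + d}"
  using assms transposition_product_permutes[of "Suc k" d g] by (simp add: excedent_between_Suc)

text \<open>The remaining product permutes only letters above \<open>Suc k\<close>. So
  \<open>Suc k\<close> is a new letter when its own transposition is composed on the right.\<close>

lemma transposition_product_Suc_fix:
  assumes "excedent_between k (k + Suc d) g"
  shows "transposition_product g (Suc k) d (Suc k) = Suc k"
  using transposition_product_Suc_permutes[OF assms] by (simp add: permutes_def)

lemma transposition_product_Suc_greater:
  assumes "excedent_between k (k + Suc d) g" "v > Suc k"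
  shows "transposition_product g (Suc k) d v > Suc k"
proof (cases "v \<le> Suc k + d")
  case True
  with assms(2) show ?thesis
    using permutes_in_image[OF transposition_product_Suc_permutes[OF assms(1)], of v] by simp
next
  case False
  then show ?thesis
    using permutes_not_in[OF transposition_product_Suc_permutes[OF assms(1)], of v] assms(2) by simp
qed

text \<open>The three cases say which letter ends up directly after \<open>v\<close>: a smaller one
  inserted later, \<open>v\<close> itself, or a larger one already present. The induction follows
  the insertion of the least letter \<open>Suc k\<close>: it changes the image of \<open>v\<close>
  only if \<open>v\<close> is \<open>Suc k\<close> or \<open>g (Suc k)\<close>.\<close>

lemma transposition_product_cases:
  assumes "excedent_between k (k + d) g" "v \<in> {k<..k + d}"
  shows "(\<exists>j\<in>{k<..<v}. g j = v) \<and> transposition_product g k d v < v \<or>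
    (\<forall>j\<in>{k<..<v}. g j \<noteq> v) \<and> g v = v \<and> transposition_product g k d v = v \<or>
    (\<forall>j\<in>{k<..<v}. g j \<noteq> v) \<and> g v \<noteq> v \<and> transposition_product g k d v > v"
  using assms
proof (induction d arbitrary: k)
  case (Suc d)
  let ?\<sigma> = "transposition_product g (Suc k) d"
  have w: "g (Suc k) \<ge> Suc k"
    using Suc.prems by (auto simp: excedent_between_def)
  show ?case
  proof (cases "v = Suc k")
    case True
    show ?thesis
    proof (cases "g (Suc k) = Suc k")
      case True
      with \<open>v = Suc k\<close> show ?thesis
        using transposition_product_Suc_fix[OF Suc.prems(1)] by auto
    next
      case False
      with w have "?\<sigma> (g (Suc k)) > Suc k"
        using transposition_product_Suc_greater[OF Suc.prems(1)] by simp
      with \<open>v = Suc k\<close> False show ?thesis by auto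
    qed
  next
    case False
    with Suc.prems have v: "v \<in> {Suc k<..Suc k + d}" by auto
    show ?thesis
    proof (cases "g (Suc k) = v")
      case True
      \<comment> \<open>The transposition sends \<open>v\<close> to \<open>Suc k\<close>, which the
        remaining product fixes. As the smallest letter is inserted last, no later insertion can
        displace it.\<close>
      with v have "transposition_product g k (Suc d) v = Suc k"
        using transposition_product_Suc_fix[OF Suc.prems(1)] by simp
      with True v show ?thesis by auto
    next
      case False
      have "{k<..<v} = insert (Suc k) {Suc k<..<v}" using v by auto
      moreover have "transposition_product g k (Suc d) v = ?\<sigma> v"
        using v False by (simp add: transpose_apply_other)
      ultimately show ?thesis
        using Suc.IH[of "Suc k"] v False excedent_between_Suc[OF Suc.prems(1)] by simp
    qed
  qed
qed simp

section \<open>Cycle maxima of the product\<close>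

text \<open>Composing with the transposition turns the step from \<open>w\<close> to
  \<open>\<sigma> w\<close> into the detour through \<open>a\<close>, so \<open>a\<close> is
  inserted directly after \<open>w\<close> and nothing else in the cycles changes.\<close>

lemma orbit_comp_transpose:
  assumes "permutation \<sigma>" "\<sigma> a = a" "i \<noteq> a"
  shows "orbit (\<sigma> \<circ> transpose a w) i - {a} = orbit \<sigma> i"
proof -
  let ?\<tau> = "\<sigma> \<circ> transpose a w"
  have inj: "inj \<sigma>" using assms(1) by (simp add: bij_is_inj permutation_bijective)
  have ne: "\<sigma> y \<noteq> a" if "y \<noteq> a" for y
    using inj assms(2) that by (metis injD)
  have w: "?\<tau> w = a" and a: "?\<tau> a = \<sigma> w" using assms(2) by simp_all
  have other: "?\<tau> y = \<sigma> y" if "y \<noteq> a" "y \<noteq> w" for y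
    using that by simp
  \<comment> \<open>The induction needs an invariant at \<open>a\<close> as well: a visit to
    \<open>a\<close> comes from \<open>w\<close>, which lets the next point
    \<open>\<sigma> w\<close> be recognised as a member of the old orbit.\<close>
  have "x \<in> orbit ?\<tau> i \<Longrightarrow> if x = a then w = a \<or> w \<in> orbit \<sigma> i else x \<in> orbit \<sigma> i" for x
  proof (induction rule: orbit.induct)
    case base
    show ?case
    proof (cases "i = w")
      case True
      then show ?thesis using w permutation_self_in_orbit[OF assms(1), of w] by simp
    next
      case False
      then show ?thesis using other[of i] ne[of i] assms(3) by (simp add: orbit.base)
    qed
  next
    case (step y)
    show ?case
    proof (cases "y = a")
      case True
      with step a ne[of w] assms(2) show ?thesis by (auto intro: orbit.step)
    next
      case False
      with step other[of y] w ne[of y] show ?thesis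
        by (cases "y = w") (auto intro: orbit.step)
    qed
  qed
  then have "orbit ?\<tau> i - {a} \<subseteq> orbit \<sigma> i"
    by (metis (full_types) DiffD1 DiffD2 singletonI subsetI)
  moreover have "x \<in> orbit \<sigma> i \<Longrightarrow> x \<in> orbit ?\<tau> i \<and> x \<noteq> a" for x
  proof (induction rule: orbit.induct)
    case base
    show ?case
    proof (cases "i = w")
      case True
      \<comment> \<open>One step of \<open>\<sigma>\<close> from \<open>w\<close> is two steps of
        \<open>?\<tau>\<close>, through \<open>a\<close>.\<close>
      then have "?\<tau> (?\<tau> i) = \<sigma> i" using w a by simp
      then show ?thesis using ne[OF assms(3)] by (metis orbit.base orbit.step)
    next
      case False
      then show ?thesis using other[of i] ne[of i] assms(3) by (metis orbit.base)
    qed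
  next
    case (step y)
    show ?case
    proof (cases "y = w")
      case True
      then have "?\<tau> (?\<tau> y) = \<sigma> y" using w a by simp
      then show ?thesis using ne[of y] step.IH by (metis orbit.step)
    next
      case False
      then show ?thesis using other[of y] ne[of y] step.IH by (metis orbit.step)
    qed
  qed
  ultimately show ?thesis by blast
qed

text \<open>Inserting the least letter never affects whether a larger letter is the maximum of its
  cycle, so this is decided when \<open>v\<close> itself is inserted: it opens a new cycle exactly
  if \<open>g v = v\<close>.\<close>

lemma cycle_maximum_transposition_product:
  assumes "excedent_between k (k + d) g" "v \<in> {k<..k + d}"
  shows "cycle_maximum (transposition_product g k d) v \<longleftrightarrow> g v = v"
  using assms
proof (induction d arbitrary: k)
  case (Suc d)
  let ?\<sigma> = "transposition_product g (Suc k) d"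
  let ?\<tau> = "transposition_product g k (Suc d)"
  have permutation_tau: "permutation ?\<tau>"
    using transposition_product_permutes[OF Suc.prems(1)]
    by (metis finite_greaterThanAtMost permutation_permutes)
  have permutation_sigma: "permutation ?\<sigma>"
    using transposition_product_Suc_permutes[OF Suc.prems(1)]
    by (metis finite_greaterThanAtMost permutation_permutes)
  show ?case
  proof (cases "v = Suc k")
    case True
    \<comment> \<open>Here \<open>v\<close> is the least letter permuted, so
      \<open>?\<tau> v \<le> v\<close> already makes it a fixed point.\<close>
    have "cycle_maximum ?\<tau> v \<longleftrightarrow> ?\<tau> v \<le> v"
    proof
      show "?\<tau> v \<le> v" if "cycle_maximum ?\<tau> v"
        using that by (auto simp only: cycle_maximum_def intro: orbit.base)
    next
      assume "?\<tau> v \<le> v"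
      moreover have "?\<tau> v \<in> {k<..k + Suc d}"
        using permutes_in_image[OF transposition_product_permutes[OF Suc.prems(1)]] Suc.prems(2)
        by blast
      ultimately have fix_v: "?\<tau> v = v" using True by simp
      have "x \<in> orbit ?\<tau> v \<Longrightarrow> x = v" for x
        by (induction rule: orbit.induct) (simp_all only: fix_v)
      then show "cycle_maximum ?\<tau> v"
        using permutation_self_in_orbit[OF permutation_tau, of v] unfolding cycle_maximum_def by blast
    qed
    also have "\<dots> \<longleftrightarrow> g v = v"
      using transposition_product_cases[OF Suc.prems] True by auto
    finally show ?thesis .
  next
    case False
    with Suc.prems have v: "v \<in> {Suc k<..Suc k + d}" by auto
    have "orbit ?\<tau> v - {Suc k} = orbit ?\<sigma> v"
      using orbit_comp_transpose[OF permutation_sigma transposition_product_Suc_fix[OF Suc.prems(1)]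
          False]
      by simp
    \<comment> \<open>The two orbits differ at most by \<open>Suc k\<close>, which lies below
      \<open>v\<close>.\<close>
    then have "(\<forall>i\<in>orbit ?\<tau> v. i \<le> v) \<longleftrightarrow> (\<forall>i\<in>orbit ?\<sigma> v. i \<le> v)"
      using v by (metis DiffE DiffI greaterThanAtMost_iff less_imp_le singletonD)
    then have "cycle_maximum ?\<tau> v \<longleftrightarrow> cycle_maximum ?\<sigma> v"
      unfolding cycle_maximum_def
      using permutation_self_in_orbit[OF permutation_tau, of v]
        permutation_self_in_orbit[OF permutation_sigma, of v] by blast
    also have "\<dots> \<longleftrightarrow> g v = v"
      using Suc.IH[of "Suc k"] v excedent_between_Suc[OF Suc.prems(1)] by simp
    finally show ?thesis .
  qed
qed simp

section \<open>Every permutation is such a product in exactly one way\<close>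

text \<open>The value \<open>g (Suc k)\<close> can be read off as the preimage of
  \<open>Suc k\<close> under the product; cancelling its transposition reduces to the remaining
  letters.\<close>

lemma transposition_product_inj:
  assumes "excedent_between k (k + d) g" "excedent_between k (k + d) h"
    and "transposition_product g k d = transposition_product h k d" "i \<in> {k<..k + d}"
  shows "g i = h i"
  using assms
proof (induction d arbitrary: k)
  case (Suc d)
  let ?\<tau> = "transposition_product g k (Suc d)"
  have "?\<tau> (g (Suc k)) = Suc k"
    using transposition_product_Suc_fix[OF Suc.prems(1)] by simp
  moreover have "?\<tau> (h (Suc k)) = Suc k"
    unfolding Suc.prems(3) using transposition_product_Suc_fix[OF Suc.prems(2)] by simp
  ultimately have eq: "g (Suc k) = h (Suc k)"
    using transposition_product_permutes[OF Suc.prems(1)] by (metis permutes_inj injD)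
  have "?\<tau> \<circ> transpose (Suc k) (g (Suc k)) =
      transposition_product h k (Suc d) \<circ> transpose (Suc k) (h (Suc k))"
    by (simp only: Suc.prems(3) eq)
  then have "transposition_product g (Suc k) d = transposition_product h (Suc k) d"
    by (simp only: transposition_product.simps comp_assoc transpose_comp_involutory comp_id)
  then show ?case
    using Suc.IH[of "Suc k"] Suc.prems excedent_between_Suc eq by (cases "i = Suc k") auto
qed simp

text \<open>The preimage \<open>w\<close> of the least letter is the only possible value of
  \<open>g\<close> there. Composing with the transposition of \<open>Suc k\<close> and
  \<open>w\<close> removes \<open>Suc k\<close> from its cycle and leaves a permutation of the
  larger letters.\<close>

lemma transposition_product_surj:
  assumes "\<sigma> permutes {k<..k + d}"
  shows "\<exists>g. excedent_between k (k + d) g \<and> transposition_product g k d = \<sigma>"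
  using assms
proof (induction d arbitrary: k \<sigma>)
  case 0
  then show ?case by (auto simp: excedent_between_def)
next
  case (Suc d)
  define w where "w = inv \<sigma> (Suc k)"
  have w: "w \<in> {k<..k + Suc d}"
    unfolding w_def using permutes_in_image[OF permutes_inv[OF Suc.prems], of "Suc k"] by simp
  have \<sigma>w: "\<sigma> w = Suc k"
    unfolding w_def using permutes_inverses(1)[OF Suc.prems] .
  let ?\<rho> = "\<sigma> \<circ> transpose (Suc k) w"
  have "transpose (Suc k) w permutes {k<..k + Suc d}"
    using w by (intro permutes_swap_id) auto
  then have "?\<rho> permutes {k<..k + Suc d}"
    using Suc.prems by (rule permutes_compose)
  then have "?\<rho> permutes {Suc k<..Suc k + d}"
  proof (rule permutes_superset)
    fix x assume "x \<in> {k<..k + Suc d} - {Suc k<..Suc k + d}"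
    then have "x = Suc k" by auto
    then show "?\<rho> x = x" using \<sigma>w by simp
  qed
  then obtain g where g: "excedent_between (Suc k) (Suc k + d) g"
      "transposition_product g (Suc k) d = ?\<rho>"
    using Suc.IH by blast
  let ?g = "g(Suc k := w)"
  have "transposition_product ?g (Suc k) d = ?\<rho>"
    using g(2) transposition_product_cong[of "Suc k" d ?g g] by simp
  then have "transposition_product ?g k (Suc d) = \<sigma>"
    by (simp add: comp_assoc)
  moreover have "excedent_between k (k + Suc d) ?g"
    using g(1) w by (auto simp: excedent_between_def)
  ultimately show ?case by blast
qed

section \<open>D-permutations and staircases in terms of their values\<close>

lemma transposition_product_D_permutation_iff:
  assumes "excedent_between 0 (2 * n) g"
  shows "transposition_product g 0 (2 * n) \<in> D_permutations n \<longleftrightarrow>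
    (\<forall>i\<in>{1..2 * n}. g i = i \<or> even (g i)) \<and> (\<forall>v\<in>{1..2 * n}. even v \<longrightarrow> v \<in> g ` {1..2 * n})"
proof -
  let ?\<sigma> = "transposition_product g 0 (2 * n)"
  have perm: "?\<sigma> permutes {1..2 * n}"
    using transposition_product_permutes[of 0 "2 * n" g] assms
    by (simp flip: atLeastSucAtMost_greaterThanAtMost)
  have ge: "i \<le> g i \<and> g i \<le> 2 * n" if "i \<in> {1..2 * n}" for i
    using assms that by (auto simp: excedent_between_def)
  have cases: "(\<exists>j\<in>{0<..<v}. g j = v) \<and> ?\<sigma> v < v \<or>
      (\<forall>j\<in>{0<..<v}. g j \<noteq> v) \<and> g v = v \<and> ?\<sigma> v = v \<or>
      (\<forall>j\<in>{0<..<v}. g j \<noteq> v) \<and> g v \<noteq> v \<and> ?\<sigma> v > v" if "v \<in> {1..2 * n}" for v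
    using transposition_product_cases[of 0 "2 * n" g v] assms that by simp
  have le_iff: "?\<sigma> v \<le> v \<longleftrightarrow> v \<in> g ` {1..2 * n}" if v: "v \<in> {1..2 * n}" for v
  proof -
    \<comment> \<open>Since \<open>g\<close> is excedent, a preimage of \<open>v\<close> is either
      smaller than \<open>v\<close> or \<open>v\<close> itself.\<close>
    have "v \<in> g ` {1..2 * n} \<longleftrightarrow> (\<exists>j\<in>{0<..<v}. g j = v) \<or> g v = v"
    proof
      assume "v \<in> g ` {1..2 * n}"
      then obtain j where j: "j \<in> {1..2 * n}" "g j = v" by blast
      with ge[of j] show "(\<exists>j\<in>{0<..<v}. g j = v) \<or> g v = v"
        by (cases "j = v") auto
    next
      assume "(\<exists>j\<in>{0<..<v}. g j = v) \<or> g v = v"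
      then have "\<exists>j\<in>{1..2 * n}. g j = v"
      proof (elim disjE bexE)
        fix j assume "j \<in> {0<..<v}" "g j = v"
        with v show ?thesis by (intro bexI[of _ j]) auto
      qed (use v in blast)
      then show "v \<in> g ` {1..2 * n}" by blast
    qed
    then show ?thesis using cases[OF v] by (elim disjE conjE) auto
  qed
  have ge_iff: "v \<le> ?\<sigma> v \<longleftrightarrow> (\<forall>j\<in>{0<..<v}. g j \<noteq> v)" if v: "v \<in> {1..2 * n}" for v
    using cases[OF v] by (elim disjE conjE) auto
  \<comment> \<open>An odd \<open>v\<close> with a smaller preimage is the same as an odd value
    \<open>g i\<close> with \<open>g i \<noteq> i\<close>.\<close>
  have "(\<forall>v\<in>{1..2 * n}. odd v \<longrightarrow> v \<le> ?\<sigma> v) \<longleftrightarrow> (\<forall>i\<in>{1..2 * n}. g i = i \<or> even (g i))"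
  proof
    assume L: "\<forall>v\<in>{1..2 * n}. odd v \<longrightarrow> v \<le> ?\<sigma> v"
    show "\<forall>i\<in>{1..2 * n}. g i = i \<or> even (g i)"
    proof
      fix i assume i: "i \<in> {1..2 * n}"
      show "g i = i \<or> even (g i)"
      proof (rule ccontr)
        assume "\<not> (g i = i \<or> even (g i))"
        moreover from this have "i \<in> {0<..<g i}" using ge[OF i] i by auto
        moreover have "g i \<in> {1..2 * n}" using ge[OF i] i by auto
        ultimately show False using L ge_iff[of "g i"] by blast
      qed
    qed
  next
    assume R: "\<forall>i\<in>{1..2 * n}. g i = i \<or> even (g i)"
    show "\<forall>v\<in>{1..2 * n}. odd v \<longrightarrow> v \<le> ?\<sigma> v"
    proof (intro ballI impI)
      fix v assume v: "v \<in> {1..2 * n}" "odd v"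
      have "g j \<noteq> v" if "j \<in> {0<..<v}" for j
        using R[rule_format, of j] that v by auto
      then show "v \<le> ?\<sigma> v" using ge_iff[OF v(1)] by blast
    qed
  qed
  moreover have "(\<forall>v\<in>{1..2 * n}. even v \<longrightarrow> ?\<sigma> v \<le> v) \<longleftrightarrow>
      (\<forall>v\<in>{1..2 * n}. even v \<longrightarrow> v \<in> g ` {1..2 * n})"
    using le_iff by blast
  ultimately show ?thesis
    unfolding D_permutations_def using perm by blast
qed

text \<open>The value \<open>2 * n + 2\<close> is always attained, at \<open>2 * n + 2\<close>, and
  values up to \<open>2 * n\<close> can only come from positions up to \<open>2 * n\<close>. So
  surjectivity becomes a condition on \<open>{1..2 * n}\<close>, the domain of
  \<open>g\<close>.\<close>

lemma surjective_staircases_iff: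
  "f \<in> surjective_staircases (Suc n) \<longleftrightarrow>
     f \<in> extensional {1..2 * n + 2} \<and>
     (\<forall>i\<in>{1..2 * n + 2}. i \<le> f i \<and> f i \<le> 2 * n + 2 \<and> even (f i)) \<and>
     (\<forall>v\<in>{1..2 * n}. even v \<longrightarrow> v \<in> f ` {1..2 * n})"
  (is "?L \<longleftrightarrow> ?R")
proof -
  have evens: "(\<lambda>i. 2 * i) ` {1..Suc n} = {v \<in> {1..2 * n + 2}. even v}"
    by (force elim!: evenE)
  have bound: "2 * Suc n = 2 * n + 2" by simp
  show ?thesis
  proof
    assume ?L
    then have ext: "f \<in> {1..2 * n + 2} \<rightarrow>\<^sub>E {1..2 * n + 2}"
      and ge: "\<forall>i\<in>{1..2 * n + 2}. i \<le> f i"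
      and im: "f ` {1..2 * n + 2} = {v \<in> {1..2 * n + 2}. even v}"
      unfolding surjective_staircases_def excedent_functions_def evens bound by auto
    have "v \<in> f ` {1..2 * n}" if v: "v \<in> {1..2 * n}" "even v" for v
    proof -
      have "v \<in> f ` {1..2 * n + 2}" using v im by auto
      then obtain j where j: "j \<in> {1..2 * n + 2}" "f j = v" by blast
      with ge v have "j \<in> {1..2 * n}" by fastforce
      with j show ?thesis by blast
    qed
    moreover have "even (f i)" if "i \<in> {1..2 * n + 2}" for i
      using im that by blast
    ultimately show ?R using ext ge by (simp add: PiE_iff)
  next
    assume R: ?R
    have "f (2 * n + 2) = 2 * n + 2" using R
      by (meson atLeastAtMost_iff le_add2 le_antisym le_refl one_le_numeral order_trans)
    have "{v \<in> {1..2 * n + 2}. even v} \<subseteq> f ` {1..2 * n + 2}"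
    proof
      fix v assume v: "v \<in> {v \<in> {1..2 * n + 2}. even v}"
      show "v \<in> f ` {1..2 * n + 2}"
      proof (cases "v \<le> 2 * n")
        case True
        then have "v \<in> f ` {1..2 * n}" using v R by simp
        then show ?thesis by force
      next
        case False
        with v have "v \<noteq> 2 * n + 1" by auto
        with False v have "v = f (2 * n + 2)" using \<open>f (2 * n + 2) = 2 * n + 2\<close> by simp
        then show ?thesis by simp
      qed
    qed
    moreover have "f ` {1..2 * n + 2} \<subseteq> {v \<in> {1..2 * n + 2}. even v}"
      using R by fastforce
    ultimately have "f ` {1..2 * n + 2} = {v \<in> {1..2 * n + 2}. even v}" by blast
    moreover have "f i \<in> {1..2 * n + 2}" if "i \<in> {1..2 * n + 2}" for i
      using R[THEN conjunct2, THEN conjunct1, rule_format, OF that] that by simp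
    then have "f \<in> {1..2 * n + 2} \<rightarrow>\<^sub>E {1..2 * n + 2}"
      using R by (simp add: PiE_iff)
    ultimately show ?L
      unfolding surjective_staircases_def excedent_functions_def evens bound using R by auto
  qed
qed

section \<open>From staircases to D-permutations\<close>

definition staircases_without_even_maxima :: "nat \<Rightarrow> (nat \<Rightarrow> nat) set" where
  "staircases_without_even_maxima n =
     {f \<in> surjective_staircases (n + 1). \<not> (\<exists>j. even j \<and> staircase_maximum (n + 1) f j)}"

text \<open>This recovers \<open>g\<close> from the staircase, undoing the redirection of odd fixed
  points to \<open>2 * n + 2\<close>.\<close>

definition maxima_to_fixed_points :: "nat \<Rightarrow> (nat \<Rightarrow> nat) \<Rightarrow> nat \<Rightarrow> nat" where
  "maxima_to_fixed_points n f i = (if f i = 2 * n + 2 then i else f i)"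

text \<open>This map goes from staircases to permutations; the bijection of the theorem is its
  inverse.\<close>

definition staircase_to_permutation :: "nat \<Rightarrow> (nat \<Rightarrow> nat) \<Rightarrow> nat \<Rightarrow> nat" where
  "staircase_to_permutation n f = transposition_product (maxima_to_fixed_points n f) 0 (2 * n)"

context
  fixes n :: nat and f :: "nat \<Rightarrow> nat"
  assumes f: "f \<in> staircases_without_even_maxima n"
begin

lemma staircase_bounds:
  "i \<in> {1..2 * n + 2} \<Longrightarrow> i \<le> f i \<and> f i \<le> 2 * n + 2 \<and> even (f i)"
  using f by (simp add: staircases_without_even_maxima_def surjective_staircases_iff)

lemma staircase_even_less:
  assumes "i \<in> {1..2 * n}" "even i"
  shows "f i \<le> 2 * n"
proof -
  have "f i \<noteq> 2 * n + 2"
    using f assms by (auto simp: staircases_without_even_maxima_def staircase_maximum_def)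
  moreover have "f i \<le> 2 * n + 2" "even (f i)" using staircase_bounds[of i] assms by auto
  moreover from this have "f i \<noteq> 2 * n + 1" by auto
  ultimately show ?thesis by linarith
qed

text \<open>Parity separates the two sources of fixed points: an odd \<open>i\<close> is not fixed
  by \<open>f\<close>, whose values are even, and an even \<open>i\<close> is not a maximum.\<close>

lemma maxima_to_fixed_points_fixed_iff:
  assumes "i \<in> {1..2 * n}"
  shows "maxima_to_fixed_points n f i = i \<longleftrightarrow> (if even i then f i = i else f i = 2 * n + 2)"
  using staircase_bounds[of i] staircase_even_less[of i] assms
  by (auto simp: maxima_to_fixed_points_def)

lemma excedent_maxima_to_fixed_points:
  "excedent_between 0 (2 * n) (maxima_to_fixed_points n f)"
  unfolding excedent_between_def
proof
  fix i assume i: "i \<in> {0<..2 * n}"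
  then have "i \<le> f i" "f i \<le> 2 * n + 2" "even (f i)" using staircase_bounds[of i] by auto
  moreover from this have "f i \<noteq> 2 * n + 1" by auto
  ultimately show "i \<le> maxima_to_fixed_points n f i \<and> maxima_to_fixed_points n f i \<le> 2 * n"
    using i by (auto simp: maxima_to_fixed_points_def)
qed

lemma staircase_to_permutation_in_D_permutations:
  "staircase_to_permutation n f \<in> D_permutations n"
  unfolding staircase_to_permutation_def
    transposition_product_D_permutation_iff[OF excedent_maxima_to_fixed_points]
proof (intro conjI ballI impI)
  fix i assume "i \<in> {1..2 * n}"
  then show "maxima_to_fixed_points n f i = i \<or> even (maxima_to_fixed_points n f i)"
    using staircase_bounds[of i] by (simp add: maxima_to_fixed_points_def)
next
  fix v assume v: "v \<in> {1..2 * n}" "even v"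
  then have "v \<in> f ` {1..2 * n}"
    using f by (simp add: staircases_without_even_maxima_def surjective_staircases_iff)
  then obtain j where j: "j \<in> {1..2 * n}" "f j = v" by blast
  then have "v = maxima_to_fixed_points n f j" using v by (simp add: maxima_to_fixed_points_def)
  then show "v \<in> maxima_to_fixed_points n f ` {1..2 * n}" using j by blast
qed

lemma staircase_to_permutation_even_cycle_maximum:
  assumes j: "j \<in> {1..2 * n}"
  shows "even j \<and> cycle_maximum (staircase_to_permutation n f) j \<longleftrightarrow> fixed_point_on (2 * n + 2) f j"
proof -
  have "cycle_maximum (staircase_to_permutation n f) j \<longleftrightarrow> maxima_to_fixed_points n f j = j"
    unfolding staircase_to_permutation_def
    using cycle_maximum_transposition_product[of 0 "2 * n"] excedent_maxima_to_fixed_points j by simp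
  moreover have "even (f j)" using staircase_bounds[of j] j by simp
  ultimately show ?thesis
    unfolding maxima_to_fixed_points_fixed_iff[OF j] fixed_point_on_def using j by auto
qed

text \<open>This is the middle case of \<open>transposition_product_cases\<close>. Redirecting
  maxima creates no new preimage of \<open>j\<close> below \<open>j\<close>, because a redirected
  letter goes to itself.\<close>

lemma staircase_to_permutation_fixed_iff:
  assumes j: "j \<in> {1..2 * n}"
  shows "staircase_to_permutation n f j = j \<longleftrightarrow>
    maxima_to_fixed_points n f j = j \<and> (\<forall>i\<in>{0<..<j}. f i \<noteq> j)"
proof -
  have "maxima_to_fixed_points n f i = j \<longleftrightarrow> f i = j" if "i \<in> {0<..<j}" for i
    using that j by (auto simp: maxima_to_fixed_points_def)
  then show ?thesis
    unfolding staircase_to_permutation_def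
    using transposition_product_cases[of 0 "2 * n" "maxima_to_fixed_points n f" j]
      excedent_maxima_to_fixed_points j by auto
qed

lemma staircase_to_permutation_even_fixed_point:
  assumes j: "j \<in> {1..2 * n}"
  shows "even j \<and> fixed_point_on (2 * n) (staircase_to_permutation n f) j \<longleftrightarrow>
    isolated_fixed_point_on (2 * n + 2) f j"
proof -
  have "even (f j)" using staircase_bounds[of j] j by simp
  moreover have "{i \<in> {1..2 * n + 2}. f i = j} = {j} \<longleftrightarrow> (\<forall>i\<in>{0<..<j}. f i \<noteq> j)" if "f j = j"
  proof
    assume single: "{i \<in> {1..2 * n + 2}. f i = j} = {j}"
    show "\<forall>i\<in>{0<..<j}. f i \<noteq> j"
    proof (intro ballI notI)
      fix i assume i: "i \<in> {0<..<j}" "f i = j"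
      then have "i \<in> {i \<in> {1..2 * n + 2}. f i = j}" using j by simp
      then have "i \<in> {j}" unfolding single .
      then show False using i(1) by simp
    qed
  next
    assume none: "\<forall>i\<in>{0<..<j}. f i \<noteq> j"
    \<comment> \<open>Excedence gives \<open>i \<le> f i = j\<close>, so only the letters below
      \<open>j\<close> have to be excluded.\<close>
    have "i = j" if "i \<in> {1..2 * n + 2}" "f i = j" for i
      using none staircase_bounds[OF that(1)] that by force
    then show "{i \<in> {1..2 * n + 2}. f i = j} = {j}" using j \<open>f j = j\<close> by auto
  qed
  ultimately show ?thesis
    unfolding isolated_fixed_point_on_def fixed_point_on_def staircase_to_permutation_fixed_iff[OF j]
      maxima_to_fixed_points_fixed_iff[OF j]
    using j by auto
qed

lemma staircase_to_permutation_odd_fixed_point: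
  assumes j: "j \<in> {1..2 * n}"
  shows "odd j \<and> fixed_point_on (2 * n) (staircase_to_permutation n f) j \<longleftrightarrow>
    odd j \<and> staircase_maximum (n + 1) f j"
proof -
  \<comment> \<open>All values of \<open>f\<close> are even, so the condition on smaller preimages
    holds for every odd \<open>j\<close>.\<close>
  have "f i \<noteq> j" if "odd j" "i \<in> {0<..<j}" for i
    using staircase_bounds[of i] that j by auto
  then show ?thesis
    unfolding fixed_point_on_def staircase_maximum_def staircase_to_permutation_fixed_iff[OF j]
      maxima_to_fixed_points_fixed_iff[OF j]
    using j by auto
qed

lemma staircase_top: "i \<in> {1..2 * n + 2} \<Longrightarrow> i \<notin> {1..2 * n} \<Longrightarrow> f i = 2 * n + 2"
proof -
  assume i: "i \<in> {1..2 * n + 2}" "i \<notin> {1..2 * n}"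
  then have "i \<le> f i" "f i \<le> 2 * n + 2" "even (f i)" using staircase_bounds[of i] by auto
  moreover from this have "f i \<noteq> 2 * n + 1" by auto
  ultimately show ?thesis using i by auto
qed

end

section \<open>Bijectivity and transfer to the inverse map\<close>

lemma inj_on_staircase_to_permutation:
  "inj_on (staircase_to_permutation n) (staircases_without_even_maxima n)"
proof (rule inj_onI)
  fix f f'
  assume f: "f \<in> staircases_without_even_maxima n" and f': "f' \<in> staircases_without_even_maxima n"
    and eq: "staircase_to_permutation n f = staircase_to_permutation n f'"
  have "f i = f' i" if i: "i \<in> {1..2 * n + 2}" for i
  proof (cases "i \<in> {1..2 * n}")
    case True
    have "maxima_to_fixed_points n f i = maxima_to_fixed_points n f' i"
      using transposition_product_inj[of 0 "2 * n"] eq True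
        excedent_maxima_to_fixed_points[OF f] excedent_maxima_to_fixed_points[OF f']
      by (simp add: staircase_to_permutation_def)
    \<comment> \<open>Equal redirected values leave one ambiguity, \<open>i\<close> against
      \<open>2 * n + 2\<close>, and the parity of \<open>i\<close> settles it.\<close>
    then show ?thesis
      using maxima_to_fixed_points_fixed_iff[OF f True] maxima_to_fixed_points_fixed_iff[OF f' True]
      by (auto simp: maxima_to_fixed_points_def split: if_splits)
  next
    case False
    then show ?thesis using staircase_top[OF f i] staircase_top[OF f' i] by simp
  qed
  moreover have "f \<in> extensional {1..2 * n + 2}" "f' \<in> extensional {1..2 * n + 2}"
    using f f' by (simp_all add: staircases_without_even_maxima_def surjective_staircases_iff)
  ultimately show "f = f'" by (meson extensionalityI)
qed

lemma staircase_to_permutation_surj: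
  assumes "\<sigma> \<in> D_permutations n"
  shows "\<exists>f\<in>staircases_without_even_maxima n. staircase_to_permutation n f = \<sigma>"
proof -
  have "\<sigma> permutes {0<..0 + 2 * n}"
    using assms by (simp add: D_permutations_def flip: atLeastSucAtMost_greaterThanAtMost)
  then obtain g where g: "excedent_between 0 (2 * n) g" "transposition_product g 0 (2 * n) = \<sigma>"
    using transposition_product_surj by fastforce
  have D: "\<forall>i\<in>{1..2 * n}. g i = i \<or> even (g i)"
      "\<forall>v\<in>{1..2 * n}. even v \<longrightarrow> v \<in> g ` {1..2 * n}"
    using transposition_product_D_permutation_iff[OF g(1)] g(2) assms by auto
  have ge: "i \<le> g i \<and> g i \<le> 2 * n" if "i \<in> {1..2 * n}" for i
    using g(1) that by (auto simp: excedent_between_def)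
  \<comment> \<open>Odd fixed points of \<open>g\<close> go to \<open>2 * n + 2\<close>, as do the
    two top positions, where this value is forced.\<close>
  define f where "f = (\<lambda>i\<in>{1..2 * n + 2}.
    if i \<le> 2 * n \<and> \<not> (odd i \<and> g i = i) then g i else 2 * n + 2)"
  have val: "f i = (if odd i \<and> g i = i then 2 * n + 2 else g i)" if "i \<in> {1..2 * n}" for i
    using that by (simp add: f_def)
  have "i \<le> f i \<and> f i \<le> 2 * n + 2 \<and> even (f i)" if "i \<in> {1..2 * n + 2}" for i
  proof (cases "i \<le> 2 * n")
    case True
    with that have "i \<in> {1..2 * n}" by simp
    then show ?thesis using D(1) ge[of i] val[of i] by fastforce
  next
    case False
    with that show ?thesis by (simp add: f_def)
  qed
  moreover have "v \<in> f ` {1..2 * n}" if v: "v \<in> {1..2 * n}" "even v" for v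
  proof -
    obtain j where "j \<in> {1..2 * n}" "v = g j" using D(2) v by blast
    \<comment> \<open>As \<open>v\<close> is even, \<open>j\<close> is not an odd fixed point of
      \<open>g\<close>, so its value was not redirected.\<close>
    with v have "v = f j" using val[of j] by auto
    then show ?thesis using \<open>j \<in> {1..2 * n}\<close> by blast
  qed
  moreover have "f \<in> extensional {1..2 * n + 2}" by (simp add: f_def)
  moreover have "\<not> staircase_maximum (n + 1) f j" if "even j" for j
    using val[of j] ge[of j] that by (auto simp: staircase_maximum_def)
  ultimately have "f \<in> staircases_without_even_maxima n"
    by (auto simp: staircases_without_even_maxima_def surjective_staircases_iff)
  moreover have "staircase_to_permutation n f = transposition_product g 0 (2 * n)"
    unfolding staircase_to_permutation_def
  proof (rule transposition_product_cong)
    fix i assume "i \<in> {0<..0 + 2 * n}"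
    then show "maxima_to_fixed_points n f i = g i"
      using val[of i] ge[of i] by (auto simp: maxima_to_fixed_points_def)
  qed
  ultimately show ?thesis using g(2) by blast
qed

lemma bij_betw_staircase_to_permutation:
  "bij_betw (staircase_to_permutation n) (staircases_without_even_maxima n) (D_permutations n)"
  unfolding bij_betw_def
  using inj_on_staircase_to_permutation staircase_to_permutation_in_D_permutations
    staircase_to_permutation_surj by blast

theorem lemma5p2:
  fixes n :: nat
  assumes "n \<ge> 1"
  shows "\<exists>\<phi>. bij_betw \<phi> (D_permutations n)
             {f \<in> surjective_staircases (n + 1). \<not> (\<exists>j. even j \<and> staircase_maximum (n + 1) f j)} \<and>
           (\<forall>\<sigma>\<in>D_permutations n. \<forall>j\<in>{1..2 * n}.
              ((even j \<and> cycle_maximum \<sigma> j) \<longleftrightarrow> fixed_point_on (2 * n + 2) (\<phi> \<sigma>) j) \<and>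
              ((even j \<and> fixed_point_on (2 * n) \<sigma> j) \<longleftrightarrow> isolated_fixed_point_on (2 * n + 2) (\<phi> \<sigma>) j) \<and>
              ((odd j \<and> fixed_point_on (2 * n) \<sigma> j) \<longleftrightarrow> (odd j \<and> staircase_maximum (n + 1) (\<phi> \<sigma>) j)))"
proof -
  let ?S = "staircases_without_even_maxima n"
  \<comment> \<open>Each \<open>\<sigma>\<close> is the permutation of the staircase
    \<open>?\<phi> \<sigma>\<close>, so the three equivalences proved for staircases apply to it
    directly.\<close>
  let ?\<phi> = "the_inv_into ?S (staircase_to_permutation n)"
  have bij: "bij_betw ?\<phi> (D_permutations n) ?S"
    by (rule bij_betw_the_inv_into[OF bij_betw_staircase_to_permutation])
  have "?\<phi> \<sigma> \<in> ?S" "staircase_to_permutation n (?\<phi> \<sigma>) = \<sigma>" if "\<sigma> \<in> D_permutations n" for \<sigma>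
    using bij_betw_apply[OF bij that] that
      f_the_inv_into_f_bij_betw[OF bij_betw_staircase_to_permutation]
    by auto
  note \<phi> = this
  have "\<forall>\<sigma>\<in>D_permutations n. \<forall>j\<in>{1..2 * n}.
      (even j \<and> cycle_maximum \<sigma> j \<longleftrightarrow> fixed_point_on (2 * n + 2) (?\<phi> \<sigma>) j) \<and>
      (even j \<and> fixed_point_on (2 * n) \<sigma> j \<longleftrightarrow> isolated_fixed_point_on (2 * n + 2) (?\<phi> \<sigma>) j) \<and>
      (odd j \<and> fixed_point_on (2 * n) \<sigma> j \<longleftrightarrow> odd j \<and> staircase_maximum (n + 1) (?\<phi> \<sigma>) j)"
    using staircase_to_permutation_even_cycle_maximum[OF \<phi>(1)]
      staircase_to_permutation_even_fixed_point[OF \<phi>(1)]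
      staircase_to_permutation_odd_fixed_point[OF \<phi>(1)]
    by (simp only: \<phi>(2)) blast
  with bij show ?thesis unfolding staircases_without_even_maxima_def by blast
qed

end
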